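(* Let $\Phi=\{\phi^t\}_{t\in\mathbb{R}}$ be a continuous flow on a compact metric space $X$. For any $t\ne0$, the flow $\Phi$ satisfies the almost specification property if and only if its time-$t$ map $\phi^t:X\to X$ satisfies the almost specification property.
   Context: A continuous flow on a compact metric space $(X,d)$ is a continuous map $\Phi:\mathbb{R}\times X\to X$, $\phi^t(x)=\Phi(t,x)$, with $\phi^0=\mathrm{id}$ and $\phi^{s+t}=\phi^s\circ\phi^t$. Discrete case. A mistake function is a function $g:\mathbb{N}\times(0,\varepsilon_0]\to\mathbb{N}\cup\{0\}$ (for some fixed $\varepsilon_0>0$) such that for every $\varepsilon\in(0,\varepsilon_0]$, $g(n,\varepsilon)$ is nondecreasing in $n$ and $\lim_{n\to\infty}g(n,\varepsilon)/n=0$; it is extended by $g(n,\varepsilon):=g(n,\varepsilon_0)$ for $\varepsilon>\varepsilon_0$. For a continuous map $f:X\to X$, $n\in\mathbb{N}$ and $\varepsilon>0$ with $n>g(n,\varepsilon)$, let $B^f_n(g|x,\varepsilon)$ be the set of $y\in X$ for which there is $\Lambda\subseteq\{0,1,\dots,n-1\}$ with $\#\Lambda\ge n-g(n,\varepsilon)$ and $\max_{j\in\Lambda}d(f^jx,f^jy)<\varepsilon$. The map $f$ has the almost specification property if there is a mistake function $g$ such that: given $\varepsilon_1,\dots,\varepsilon_k>0$ there are integers $N_g(\varepsilon_1),\dots,N_g(\varepsilon_k)$ such that for any $x_1,\dots,x_k\in X$ and integers $n_i\ge N_g(\varepsilon_i)$, $i=1,\dots,k$, there is $z\in X$ with $f^{N_j}(z)\in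 B^f_{n_j}(g|x_j,\varepsilon_j)$ for all $j=1,\dots,k$, where $n_0=0$ and $N_j=n_0+n_1+\dots+n_{j-1}$. Flow case. A mistake function is a function $g:\mathbb{R}^+\times(0,\varepsilon_0]\to\mathbb{R}^+$ (for some fixed $\varepsilon_0>0$; $\mathbb{R}^+$ the positive reals) such that for every $\varepsilon\in(0,\varepsilon_0]$, $g(\cdot,\varepsilon)$ is continuous and nondecreasing and $\lim_{t\to\infty}g(t,\varepsilon)/t=0$; it is extended by $g(t,\varepsilon):=g(t,\varepsilon_0)$ for $\varepsilon>\varepsilon_0$. For $T>0$ let $B^\Phi_T(g|x,\varepsilon)$ be the set of $y\in X$ for which there is a Lebesgue measurable $\Lambda\subseteq[0,T]$ with $\lambda([0,T]\setminus\Lambda)\le g(T,\varepsilon)$ ($\lambda$ Lebesgue measure) and $\sup_{t\in\Lambda}d(\phi^tx,\phi^ty)<\varepsilon$. The flow $\Phi$ has the almost specification property if there is a mistake function $g$ such that for any positive integer $k$ and any $\varepsilon_1,\dots,\varepsilon_k>0$ there are positive numbers $T_g(\varepsilon_1),\dots,T_g(\varepsilon_k)$ such that for all $x_1,\dots,x_k\in X$ and times $t_i\ge T_g(\varepsilon_i)$, $i=1,\dots,k$, there is $z\in X$ with $\phi^{T_j}(z)\in B^\Phi_{t_j}(g|x_j,\varepsilon_j)$ for all $j=1,\dots,k$, where $t_0=0$ and $T_j=t_0+t_1+\dots+t_{j-1}$. *)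

theory Defs
  imports "HOL-Analysis.Analysis"
begin

definition continuous_flow :: "(real \<Rightarrow> 'a::topological_space \<Rightarrow> 'a) \<Rightarrow> bool" where
  "continuous_flow \<Phi> \<longleftrightarrow>
     continuous_on UNIV (\<lambda>(t, x). \<Phi> t x) \<and>
     \<Phi> 0 = id \<and>
     (\<forall>s t. \<Phi> (s + t) = \<Phi> s \<circ> \<Phi> t)"

text \<open>A mistake function has second argument in the interval from 0 (excluded) to
  \<open>\<epsilon>\<^sub>0\<close> (included). It is a total function here, whose values elsewhere are never used:
  all uses go through the following extension, which is constant beyond \<open>\<epsilon>\<^sub>0\<close>.\<close>

definition extend_mistake :: "real \<Rightarrow> ('n \<Rightarrow> real \<Rightarrow> 'm) \<Rightarrow> 'n \<Rightarrow> real \<Rightarrow> 'm" where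
  "extend_mistake \<epsilon>\<^sub>0 g n \<epsilon> = g n (if \<epsilon> \<le> \<epsilon>\<^sub>0 then \<epsilon> else \<epsilon>\<^sub>0)"


subsection \<open>Maps\<close>

text \<open>The first argument of a mistake function ranges over the positive integers.\<close>

definition mistake_function :: "real \<Rightarrow> (nat \<Rightarrow> real \<Rightarrow> nat) \<Rightarrow> bool" where
  "mistake_function \<epsilon>\<^sub>0 g \<longleftrightarrow>
     0 < \<epsilon>\<^sub>0 \<and>
     (\<forall>\<epsilon>\<in>{0<..\<epsilon>\<^sub>0}.
        mono_on {1..} (\<lambda>n. g n \<epsilon>) \<and>
        (\<lambda>n. real (g n \<epsilon>) / real n) \<longlonglongrightarrow> 0)"

definition mistake_ball ::
  "('a::metric_space \<Rightarrow> 'a) \<Rightarrow> (nat \<Rightarrow> real \<Rightarrow> nat) \<Rightarrow> nat \<Rightarrow> 'a \<Rightarrow> real \<Rightarrow> 'a set" where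
  "mistake_ball f g n x \<epsilon> =
     {y. \<exists>\<Lambda>\<subseteq>{0..<n}. card \<Lambda> \<ge> n - g n \<epsilon> \<and>
           (\<forall>j\<in>\<Lambda>. dist ((f ^^ j) x) ((f ^^ j) y) < \<epsilon>)}"

text \<open>Orbit segments are indexed from 0 to \<open>k - 1\<close>. The ball \<open>mistake_ball f g n x \<epsilon>\<close> is
  meaningful only if \<open>g n \<epsilon> < n\<close> (otherwise it is the whole space), so the thresholds are
  required to guarantee this; in particular they are positive.\<close>

definition almost_specification :: "('a::metric_space \<Rightarrow> 'a) \<Rightarrow> bool" where
  "almost_specification f \<longleftrightarrow>
     (\<exists>\<epsilon>\<^sub>0 g. mistake_function \<epsilon>\<^sub>0 g \<and>
        (\<forall>k\<ge>1. \<forall>\<epsilon> :: nat \<Rightarrow> real. (\<forall>i<k. 0 < \<epsilon> i) \<longrightarrow>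
           (\<exists>N :: real \<Rightarrow> nat.
              (\<forall>i<k. \<forall>n\<ge>N (\<epsilon> i). extend_mistake \<epsilon>\<^sub>0 g n (\<epsilon> i) < n) \<and>
              (\<forall>(x :: nat \<Rightarrow> 'a) (n :: nat \<Rightarrow> nat). (\<forall>i<k. n i \<ge> N (\<epsilon> i)) \<longrightarrow>
                 (\<exists>z. \<forall>j<k. (f ^^ (\<Sum>i<j. n i)) z
                        \<in> mistake_ball f (extend_mistake \<epsilon>\<^sub>0 g) (n j) (x j) (\<epsilon> j))))))"


subsection \<open>Flows\<close>

definition flow_mistake_function :: "real \<Rightarrow> (real \<Rightarrow> real \<Rightarrow> real) \<Rightarrow> bool" where
  "flow_mistake_function \<epsilon>\<^sub>0 g \<longleftrightarrow>
     0 < \<epsilon>\<^sub>0 \<and>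
     (\<forall>\<epsilon>\<in>{0<..\<epsilon>\<^sub>0}.
        (\<forall>t>0. 0 < g t \<epsilon>) \<and>
        continuous_on {0<..} (\<lambda>t. g t \<epsilon>) \<and>
        mono_on {0<..} (\<lambda>t. g t \<epsilon>) \<and>
        ((\<lambda>t. g t \<epsilon> / t) \<longlongrightarrow> 0) at_top)"

text \<open>The set \<open>\<Lambda>\<close> may be empty when \<open>T \<le> g T \<epsilon>\<close>; the condition on the supremum then holds
  vacuously. The supremum of the empty set of reals is unspecified and must be guarded.
  On a compact space the other suprema are over bounded sets.\<close>

definition flow_mistake_ball ::
  "(real \<Rightarrow> 'a::metric_space \<Rightarrow> 'a) \<Rightarrow> (real \<Rightarrow> real \<Rightarrow> real) \<Rightarrow> real \<Rightarrow> 'a \<Rightarrow> real \<Rightarrow> 'a set" where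
  "flow_mistake_ball \<Phi> g T x \<epsilon> =
     {y. \<exists>\<Lambda>\<subseteq>{0..T}. \<Lambda> \<in> sets lebesgue \<and>
           measure lebesgue ({0..T} - \<Lambda>) \<le> g T \<epsilon> \<and>
           (\<Lambda> \<noteq> {} \<longrightarrow> (SUP t\<in>\<Lambda>. dist (\<Phi> t x) (\<Phi> t y)) < \<epsilon>)}"

definition flow_almost_specification :: "(real \<Rightarrow> 'a::metric_space \<Rightarrow> 'a) \<Rightarrow> bool" where
  "flow_almost_specification \<Phi> \<longleftrightarrow>
     (\<exists>\<epsilon>\<^sub>0 g. flow_mistake_function \<epsilon>\<^sub>0 g \<and>
        (\<forall>k\<ge>1. \<forall>\<epsilon> :: nat \<Rightarrow> real. (\<forall>i<k. 0 < \<epsilon> i) \<longrightarrow>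
           (\<exists>T :: real \<Rightarrow> real.
              (\<forall>i<k. 0 < T (\<epsilon> i)) \<and>
              (\<forall>(x :: nat \<Rightarrow> 'a) (t :: nat \<Rightarrow> real). (\<forall>i<k. t i \<ge> T (\<epsilon> i)) \<longrightarrow>
                 (\<exists>z. \<forall>j<k. \<Phi> (\<Sum>i<j. t i) z
                        \<in> flow_mistake_ball \<Phi> (extend_mistake \<epsilon>\<^sub>0 g) (t j) (x j) (\<epsilon> j))))))"

end

theory Submission
  imports Defs
begin

text \<open>Over a bounded stretch of time the flow of a compact space is equicontinuous: closeness of two
  points at one instant forces closeness at all times at most \<open>\<tau>\<close> earlier or later,
  at the price of replacing a precision \<open>\<epsilon>\<close> by some smaller \<open>\<delta> \<epsilon>\<close> (\<open>flow_modulus\<close>). Hence the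
  times at which two flow orbits are apart and the iterates at which the orbits of the time-\<open>\<tau>\<close>
  map are apart control each other, one bad iterate costing at most one block of length \<open>\<tau>\<close>.

  For \<open>\<tau> > 0\<close> and a flow with almost specification, orbit segments of the map of lengths \<open>n\<^sub>i\<close> are
  flow segments of lengths \<open>n\<^sub>i \<tau>\<close>. A bad iterate starts a block all of whose times are bad, so a bad
  set of measure \<open>g\<close> leaves at most \<open>g / \<tau>\<close> bad iterates (\<open>mistake_ball_of_flow_mistake_ball\<close>).

  In the converse direction the lengths \<open>t\<^sub>i\<close> need not be multiples of \<open>\<tau>\<close>, and rounding each of them
  separately would let the errors accumulate along the concatenation. Instead the starting times
  \<open>S\<^sub>j = t\<^sub>0 + \<dots> + t\<^bsub>j-1\<^esub>\<close> are rounded up to the grid, \<open>m\<^sub>j = \<lceil>S\<^sub>j / \<tau>\<rceil>\<close>, and the map is applied to segments of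
  \<open>n\<^sub>j = m\<^bsub>j+1\<^esub> - m\<^sub>j\<close> iterates. Each flow segment then loses at most an initial stretch of length
  \<open>\<tau>\<close> in addition to the blocks of its bad iterates (\<open>flow_mistake_ball_of_mistake_ball\<close>).
  The mistakes allowed for the map form a sequence, and \<open>sublinear_majorant\<close> turns it into
  the continuous mistake function that a flow requires.

  For \<open>\<tau> < 0\<close> the map \<open>\<Phi> \<tau>\<close> is the time-\<open>\<bar>\<tau>\<bar>\<close> map of the reversed flow, and almost specification
  of a flow passes to the reversed flow: concatenate the segments in the opposite order,
  then start from the end of the shadowing orbit (\<open>flow_almost_specification_reverse\<close>).\<close>

section \<open>Flows on compact spaces\<close>

lemma flow_add:
  assumes "continuous_flow \<Phi>"
  shows "\<Phi> s (\<Phi> t x) = \<Phi> (s + t) x"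
  using assms unfolding continuous_flow_def by (metis comp_apply)

lemma flow_zero:
  assumes "continuous_flow \<Phi>"
  shows "\<Phi> 0 x = x"
  using assms unfolding continuous_flow_def by simp

lemma flow_funpow:
  assumes "continuous_flow \<Phi>"
  shows "(\<Phi> \<tau> ^^ n) x = \<Phi> (real n * \<tau>) x"
  by (induction n) (simp_all add: flow_zero[OF assms] flow_add[OF assms] algebra_simps)

lemma continuous_on_flow_time:
  assumes "continuous_flow \<Phi>"
  shows "continuous_on A (\<lambda>t. \<Phi> t x)"
proof -
  have "continuous_on A ((\<lambda>(t, x). \<Phi> t x) \<circ> (\<lambda>t. (t, x)))"
    using assms unfolding continuous_flow_def
    by (intro continuous_on_compose continuous_intros) (auto elim: continuous_on_subset)
  then show ?thesis by (simp add: o_def)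
qed

lemma continuous_flow_reverse:
  assumes "continuous_flow \<Phi>"
  shows "continuous_flow (\<lambda>t. \<Phi> (- t))"
proof -
  have "continuous_on UNIV ((\<lambda>(t, x). \<Phi> t x) \<circ> (\<lambda>(t, x). (- t, x)))"
    using assms unfolding continuous_flow_def case_prod_beta
    by (intro continuous_on_compose continuous_intros) (auto elim: continuous_on_subset)
  moreover have "\<Phi> (- s - t) = \<Phi> (- s) \<circ> \<Phi> (- t)" for s t
    using assms unfolding continuous_flow_def by (metis uminus_add_conv_diff add.commute)
  ultimately show ?thesis
    using assms unfolding continuous_flow_def by (simp add: o_def case_prod_beta)
qed

text \<open>Uniform continuity of \<open>\<Phi>\<close> on the compact set of times in \<open>[-\<tau>, \<tau>]\<close> and all points. Negative
  times are included because closeness is also transported backwards, from a time inside a block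
  to the start of that block.\<close>

lemma flow_equicontinuous:
  fixes \<Phi> :: "real \<Rightarrow> 'a::metric_space \<Rightarrow> 'a"
  assumes "compact (UNIV :: 'a set)" "continuous_flow \<Phi>" "0 < \<epsilon>"
  obtains \<delta> where "0 < \<delta>"
    "\<And>s x y. \<bar>s\<bar> \<le> \<tau> \<Longrightarrow> dist x y < \<delta> \<Longrightarrow> dist (\<Phi> s x) (\<Phi> s y) < \<epsilon>"
proof -
  have "uniformly_continuous_on ({-\<tau>..\<tau>} \<times> (UNIV :: 'a set)) (\<lambda>(t, x). \<Phi> t x)"
    using assms unfolding continuous_flow_def
    by (intro compact_uniformly_continuous compact_Times) (auto elim: continuous_on_subset)
  then obtain \<delta> where \<delta>: "0 < \<delta>"
    "\<And>p q. p \<in> {-\<tau>..\<tau>} \<times> (UNIV :: 'a set) \<Longrightarrow> q \<in> {-\<tau>..\<tau>} \<times> UNIV \<Longrightarrow> dist q p < \<delta>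
       \<Longrightarrow> dist ((\<lambda>(t, x). \<Phi> t x) q) ((\<lambda>(t, x). \<Phi> t x) p) < \<epsilon>"
    using \<open>0 < \<epsilon>\<close> unfolding uniformly_continuous_on_def by blast
  have "dist (\<Phi> s x) (\<Phi> s y) < \<epsilon>" if "\<bar>s\<bar> \<le> \<tau>" "dist x y < \<delta>" for s x y
    using \<delta>(2)[of "(s, y)" "(s, x)"] that by (auto simp: dist_Pair_Pair abs_le_iff)
  with \<delta>(1) show ?thesis by (rule that)
qed

lemma flow_modulus:
  fixes \<Phi> :: "real \<Rightarrow> 'a::metric_space \<Rightarrow> 'a"
  assumes "compact (UNIV :: 'a set)" "continuous_flow \<Phi>"
  obtains \<delta> :: "real \<Rightarrow> real" where
    "\<And>\<epsilon>. 0 < \<epsilon> \<Longrightarrow> 0 < \<delta> \<epsilon>"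
    "\<And>\<epsilon> s x y. 0 < \<epsilon> \<Longrightarrow> \<bar>s\<bar> \<le> \<tau> \<Longrightarrow> dist x y < \<delta> \<epsilon> \<Longrightarrow> dist (\<Phi> s x) (\<Phi> s y) < \<epsilon>"
proof -
  have "\<forall>\<epsilon>. \<exists>d. 0 < \<epsilon> \<longrightarrow> 0 < d \<and> (\<forall>s x y. \<bar>s\<bar> \<le> \<tau> \<longrightarrow> dist x y < d \<longrightarrow> dist (\<Phi> s x) (\<Phi> s y) < \<epsilon>)"
    using flow_equicontinuous[OF assms] by metis
  then show ?thesis using that by metis
qed

lemma bdd_above_dist_image:
  fixes p q :: "'b \<Rightarrow> 'a::metric_space"
  assumes "compact (UNIV :: 'a set)"
  shows "bdd_above ((\<lambda>t. dist (p t) (q t)) ` A)"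
proof -
  obtain e where "\<And>x y :: 'a. dist x y \<le> e"
    using compact_imp_bounded[OF assms] unfolding bounded_two_points by auto
  then show ?thesis by (intro bdd_aboveI2) auto
qed

section \<open>Time reversal\<close>

text \<open>Under the reflection \<open>u \<mapsto> T - u\<close> of \<open>[0, T]\<close>, which preserves Lebesgue measure, the
  segment of length \<open>T\<close> ending at \<open>x\<close> becomes the reversed segment starting at \<open>x\<close>.\<close>

lemma flow_mistake_ball_reverse:
  assumes flow: "continuous_flow \<Phi>"
    and w: "w \<in> flow_mistake_ball \<Phi> g T (\<Phi> (- T) x) \<epsilon>"
  shows "\<Phi> T w \<in> flow_mistake_ball (\<lambda>t. \<Phi> (- t)) g T x \<epsilon>"
proof -
  obtain \<Lambda> where \<Lambda>: "\<Lambda> \<subseteq> {0..T}" "\<Lambda> \<in> sets lebesgue"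
    "measure lebesgue ({0..T} - \<Lambda>) \<le> g T \<epsilon>"
    "\<Lambda> \<noteq> {} \<Longrightarrow> (SUP t\<in>\<Lambda>. dist (\<Phi> t (\<Phi> (- T) x)) (\<Phi> t w)) < \<epsilon>"
    using w unfolding flow_mistake_ball_def by blast
  define r where "r = (\<lambda>u::real. T - u)"
  have r_affine: "r = (\<lambda>u. (- 1) *\<^sub>R u + T)" by (auto simp: r_def)
  have sets: "r ` \<Lambda> \<in> sets lebesgue"
  proof -
    have "r -` \<Lambda> \<inter> space lebesgue \<in> sets lebesgue"
      by (rule measurable_sets[OF _ \<Lambda>(2)])
        (use lebesgue_affine_measurable[of "\<lambda>_. - 1 :: real" T] in \<open>simp add: r_def[abs_def]\<close>)
    moreover have "r -` \<Lambda> = r ` \<Lambda>" by (force simp: r_def)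
    ultimately show ?thesis by simp
  qed
  have "{0..T} - r ` \<Lambda> = r ` ({0..T} - \<Lambda>)"
  proof -
    have "r ` {0..T} = {0..T}" unfolding r_def by auto
    moreover have "inj r" by (auto simp: r_def inj_def)
    ultimately show ?thesis by (simp add: image_set_diff)
  qed
  then have meas: "measure lebesgue ({0..T} - r ` \<Lambda>) = measure lebesgue ({0..T} - \<Lambda>)"
    unfolding r_affine using measure_lebesgue_affine[of "- 1" T "{0..T} - \<Lambda>"] by simp
  have "(\<lambda>t. dist (\<Phi> (- t) x) (\<Phi> (- t) (\<Phi> T w))) ` r ` \<Lambda> = (\<lambda>t. dist (\<Phi> t (\<Phi> (- T) x)) (\<Phi> t w)) ` \<Lambda>"
    unfolding image_image r_def by (simp add: flow_add[OF flow])
  then have "r ` \<Lambda> \<noteq> {} \<longrightarrow> (SUP t\<in>r ` \<Lambda>. dist (\<Phi> (- t) x) (\<Phi> (- t) (\<Phi> T w))) < \<epsilon>"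
    using \<Lambda>(4) by simp
  moreover have "r ` \<Lambda> \<subseteq> {0..T}" using \<Lambda>(1) by (auto simp: r_def)
  ultimately show ?thesis
    unfolding flow_mistake_ball_def using sets meas \<Lambda>(3)
    by (intro CollectI exI[of _ "r ` \<Lambda>"] conjI) simp_all
qed

text \<open>With \<open>r\<close> the order reversal of the indices, the \<open>j\<close>-th backward segment is the \<open>r j\<close>-th
  forward one. The thresholds carry over because they are attached to the precisions and
  not to the positions in the list.\<close>

lemma flow_almost_specification_reverse:
  assumes flow: "continuous_flow \<Phi>" and almost_spec: "flow_almost_specification \<Phi>"
  shows "flow_almost_specification (\<lambda>t. \<Phi> (- t))"
proof -
  obtain \<epsilon>\<^sub>0 g where g: "flow_mistake_function \<epsilon>\<^sub>0 g"
    and glue: "\<And>(k :: nat) (\<epsilon> :: nat \<Rightarrow> real). k \<ge> 1 \<Longrightarrow> \<forall>i<k. 0 < \<epsilon> i \<Longrightarrow>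
       \<exists>T :: real \<Rightarrow> real. (\<forall>i<k. 0 < T (\<epsilon> i)) \<and>
         (\<forall>x t. (\<forall>i<k. t i \<ge> T (\<epsilon> i)) \<longrightarrow>
           (\<exists>z. \<forall>j<k. \<Phi> (\<Sum>i<j. t i) z
                  \<in> flow_mistake_ball \<Phi> (extend_mistake \<epsilon>\<^sub>0 g) (t j) (x j) (\<epsilon> j)))"
    using almost_spec unfolding flow_almost_specification_def
    by (elim exE conjE) (rule that, assumption, drule spec, drule (1) mp, drule spec, drule (1) mp, assumption)
  show ?thesis
    unfolding flow_almost_specification_def
  proof (rule exI[of _ \<epsilon>\<^sub>0], rule exI[of _ g], intro conjI allI impI)
    show "flow_mistake_function \<epsilon>\<^sub>0 g" by (rule g)
  next
    fix k :: nat and \<epsilon> :: "nat \<Rightarrow> real"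
    assume k: "1 \<le> k" and \<epsilon>: "\<forall>i<k. 0 < \<epsilon> i"
    define r where "r i = k - 1 - i" for i
    have r: "r i < k" "r (r i) = i" if "i < k" for i
      using that unfolding r_def by auto
    have "\<forall>i<k. 0 < \<epsilon> (r i)" using \<epsilon> r by auto
    from glue[OF k this] obtain T :: "real \<Rightarrow> real" where
      Tpos: "\<And>i. i < k \<Longrightarrow> 0 < T (\<epsilon> (r i))" and
      T: "\<And>x t. \<forall>i<k. t i \<ge> T (\<epsilon> (r i)) \<Longrightarrow> \<exists>z. \<forall>j<k. \<Phi> (\<Sum>i<j. t i) z
            \<in> flow_mistake_ball \<Phi> (extend_mistake \<epsilon>\<^sub>0 g) (t j) (x j) (\<epsilon> (r j))"
      by blast
    show "\<exists>T::real \<Rightarrow> real. (\<forall>i<k. 0 < T (\<epsilon> i)) \<and>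
       (\<forall>x t. (\<forall>i<k. T (\<epsilon> i) \<le> t i) \<longrightarrow>
         (\<exists>z. \<forall>j<k. \<Phi> (- (\<Sum>i<j. t i)) z
             \<in> flow_mistake_ball (\<lambda>t. \<Phi> (- t)) (extend_mistake \<epsilon>\<^sub>0 g) (t j) (x j) (\<epsilon> j)))"
    proof (intro exI[of _ T] conjI allI impI)
      show "0 < T (\<epsilon> i)" if "i < k" for i using Tpos[of "r i"] r[OF that] by simp
    next
      fix x :: "nat \<Rightarrow> 'a" and t :: "nat \<Rightarrow> real"
      assume t: "\<forall>i<k. T (\<epsilon> i) \<le> t i"
      have "\<forall>i<k. T (\<epsilon> (r i)) \<le> t (r i)" using t r by auto
      from T[OF this, of "\<lambda>i. \<Phi> (- t (r i)) (x (r i))"] obtain w where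
        w: "\<And>j. j < k \<Longrightarrow> \<Phi> (\<Sum>i<j. t (r i)) w
            \<in> flow_mistake_ball \<Phi> (extend_mistake \<epsilon>\<^sub>0 g) (t (r j)) (\<Phi> (- t (r j)) (x (r j))) (\<epsilon> (r j))"
        by blast
      \<comment> \<open>The backward orbit has to start where the concatenated forward orbit ends.\<close>
      show "\<exists>z. \<forall>j<k. \<Phi> (- (\<Sum>i<j. t i)) z
             \<in> flow_mistake_ball (\<lambda>t. \<Phi> (- t)) (extend_mistake \<epsilon>\<^sub>0 g) (t j) (x j) (\<epsilon> j)"
      proof (intro exI[of _ "\<Phi> (\<Sum>i<k. t i) w"] allI impI)
        fix j assume j: "j < k"
        have "(\<Sum>i<r j. t (r i)) = (\<Sum>i\<in>{j<..<k}. t i)"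
          by (rule sum.reindex_bij_witness[of _ r r]) (use j in \<open>auto simp: r_def\<close>)
        moreover have "(\<Sum>i<k. t i) = (\<Sum>i<j. t i) + (t j + (\<Sum>i\<in>{j<..<k}. t i))"
        proof -
          have "{..<k} = {..<j} \<union> insert j {j<..<k}" using j by auto
          moreover have "{..<j} \<inter> insert j {j<..<k} = {}" by auto
          ultimately show ?thesis by (simp add: sum.union_disjoint)
        qed
        ultimately have "\<Phi> (- (\<Sum>i<j. t i)) (\<Phi> (\<Sum>i<k. t i) w) = \<Phi> (t j) (\<Phi> (\<Sum>i<r j. t (r i)) w)"
          by (simp add: flow_add[OF flow])
        then show "\<Phi> (- (\<Sum>i<j. t i)) (\<Phi> (\<Sum>i<k. t i) w)
             \<in> flow_mistake_ball (\<lambda>t. \<Phi> (- t)) (extend_mistake \<epsilon>\<^sub>0 g) (t j) (x j) (\<epsilon> j)"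
          using flow_mistake_ball_reverse[OF flow w[OF r(1)[OF j], unfolded r(2)[OF j]]] by simp
      qed
    qed
  qed
qed

section \<open>From the flow to the time map\<close>

text \<open>A single good time in the block \<open>[j \<tau>, (j + 1) \<tau>)\<close> makes the \<open>j\<close>-th iterate good. The blocks
  of the bad iterates are therefore disjoint subsets of the bad time set, each of measure \<open>\<tau>\<close>.\<close>

lemma mistake_ball_of_flow_mistake_ball:
  fixes \<Phi> :: "real \<Rightarrow> 'a::metric_space \<Rightarrow> 'a"
  assumes comp: "compact (UNIV :: 'a set)" and flow: "continuous_flow \<Phi>" and \<tau>: "0 < \<tau>"
    and modulus: "\<And>s x y. \<bar>s\<bar> \<le> \<tau> \<Longrightarrow> dist x y < \<delta> \<Longrightarrow> dist (\<Phi> s x) (\<Phi> s y) < \<epsilon>"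
    and y: "y \<in> flow_mistake_ball \<Phi> g (real n * \<tau>) x \<delta>"
    and h: "g (real n * \<tau>) \<delta> / \<tau> < real (h n \<epsilon>) + 1"
  shows "y \<in> mistake_ball (\<Phi> \<tau>) h n x \<epsilon>"
proof -
  obtain \<Lambda> where \<Lambda>: "\<Lambda> \<subseteq> {0..real n * \<tau>}" "\<Lambda> \<in> sets lebesgue"
    "measure lebesgue ({0..real n * \<tau>} - \<Lambda>) \<le> g (real n * \<tau>) \<delta>"
    "\<Lambda> \<noteq> {} \<Longrightarrow> (SUP t\<in>\<Lambda>. dist (\<Phi> t x) (\<Phi> t y)) < \<delta>"
    using y unfolding flow_mistake_ball_def by blast
  have close: "dist (\<Phi> t x) (\<Phi> t y) < \<delta>" if "t \<in> \<Lambda>" for t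
    using cSUP_upper[OF that bdd_above_dist_image[OF comp, of "\<lambda>t. \<Phi> t x" "\<lambda>t. \<Phi> t y" \<Lambda>]] \<Lambda>(4) that
    by fastforce
  define I where "I j = {real j * \<tau>..<(real j + 1) * \<tau>}" for j :: nat
  define B where "B = {j\<in>{0..<n}. I j \<inter> \<Lambda> = {}}"
  have "B \<subseteq> {0..<n}" and finB: "finite B" by (auto simp: B_def)
  have good: "dist ((\<Phi> \<tau> ^^ j) x) ((\<Phi> \<tau> ^^ j) y) < \<epsilon>" if j: "j \<in> {0..<n} - B" for j
  proof -
    obtain t where t: "t \<in> I j" "t \<in> \<Lambda>" using j by (auto simp: B_def)
    have "\<bar>real j * \<tau> - t\<bar> \<le> \<tau>" using t(1) by (auto simp: I_def algebra_simps)
    from modulus[OF this close[OF t(2)]] show ?thesis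
      by (simp add: flow_add[OF flow] flow_funpow[OF flow])
  qed
  have disj: "disjoint_family_on I B"
  proof -
    have "I i \<inter> I j = {}" if "i < j" for i j
    proof -
      have "(real i + 1) * \<tau> \<le> real j * \<tau>" using that \<tau> by (intro mult_right_mono) auto
      then show ?thesis by (auto simp: I_def)
    qed
    then show ?thesis unfolding disjoint_family_on_def by (metis inf_commute linorder_neqE_nat)
  qed
  have fin: "emeasure lebesgue (I j) \<noteq> \<infinity>" for j
    using \<tau> by (simp add: I_def emeasure_lborel_Ico algebra_simps)
  have "real (card B) * \<tau> = (\<Sum>j\<in>B. measure lebesgue (I j))"
    using \<tau> by (simp add: I_def algebra_simps)
  also have "\<dots> = measure lebesgue (\<Union>j\<in>B. I j)"
    by (rule measure_finite_Union[OF finB _ disj fin, symmetric]) (auto simp: I_def)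
  also have "\<dots> \<le> measure lebesgue ({0..real n * \<tau>} - \<Lambda>)"
  proof (rule measure_mono_fmeasurable)
    show "(\<Union>j\<in>B. I j) \<subseteq> {0..real n * \<tau>} - \<Lambda>"
    proof safe
      fix j u assume j: "j \<in> B" and u: "u \<in> I j"
      have "(real j + 1) * \<tau> \<le> real n * \<tau>" using j \<tau> by (intro mult_right_mono) (auto simp: B_def)
      moreover have "0 \<le> real j * \<tau>" using \<tau> by simp
      ultimately show "u \<in> {0..real n * \<tau>}" using u unfolding I_def by auto
      show False if "u \<in> \<Lambda>" using that j u by (auto simp: B_def)
    qed
    show "(\<Union>j\<in>B. I j) \<in> sets lebesgue" by (auto simp: I_def finB intro!: sets.finite_UN)
    show "{0..real n * \<tau>} - \<Lambda> \<in> lmeasurable" using \<Lambda>(2) by (intro fmeasurable_Diff) auto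
  qed
  also have "\<dots> \<le> g (real n * \<tau>) \<delta>" by (rule \<Lambda>(3))
  also have "\<dots> < (real (h n \<epsilon>) + 1) * \<tau>" using h \<tau> by (simp add: field_simps)
  finally have "real (card B) < real (h n \<epsilon>) + 1" using \<tau> by simp
  then have "card B \<le> h n \<epsilon>" by linarith
  then have "n - h n \<epsilon> \<le> card ({0..<n} - B)"
    using card_Diff_subset[OF finB \<open>B \<subseteq> {0..<n}\<close>] by simp
  then show ?thesis
    unfolding mistake_ball_def using good by (intro CollectI exI[of _ "{0..<n} - B"]) auto
qed

text \<open>The mistake function of the map is \<open>n, \<epsilon> \<mapsto> \<lfloor>G (n \<tau>, \<delta> \<epsilon>) / \<tau>\<rfloor>\<close>, where \<open>G\<close> is the extended mistake
  function of the flow. Its sublinear growth gives the length beyond which it stays below \<open>n\<close>.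
  Its range of precisions is cut at 1, so a precision \<open>e\<close> of the map is served by the precision
  \<open>\<delta> (min e 1)\<close> of the flow.\<close>

lemma almost_specification_of_flow:
  fixes \<Phi> :: "real \<Rightarrow> 'a::metric_space \<Rightarrow> 'a"
  assumes comp: "compact (UNIV :: 'a set)" and flow: "continuous_flow \<Phi>" and \<tau>: "0 < \<tau>"
    and almost_spec: "flow_almost_specification \<Phi>"
  shows "almost_specification (\<Phi> \<tau>)"
proof -
  obtain \<epsilon>\<^sub>0 g where g: "flow_mistake_function \<epsilon>\<^sub>0 g"
    and glue: "\<And>(k :: nat) (\<epsilon> :: nat \<Rightarrow> real). k \<ge> 1 \<Longrightarrow> \<forall>i<k. 0 < \<epsilon> i \<Longrightarrow>
       \<exists>T :: real \<Rightarrow> real. (\<forall>i<k. 0 < T (\<epsilon> i)) \<and>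
         (\<forall>x t. (\<forall>i<k. t i \<ge> T (\<epsilon> i)) \<longrightarrow>
           (\<exists>z. \<forall>j<k. \<Phi> (\<Sum>i<j. t i) z
                  \<in> flow_mistake_ball \<Phi> (extend_mistake \<epsilon>\<^sub>0 g) (t j) (x j) (\<epsilon> j)))"
    using almost_spec unfolding flow_almost_specification_def
    by (elim exE conjE) (rule that, assumption, drule spec, drule (1) mp, drule spec, drule (1) mp, assumption)
  define G where "G = extend_mistake \<epsilon>\<^sub>0 g"
  have G: "\<And>t. 0 < t \<Longrightarrow> 0 < G t \<epsilon>" "mono_on {0<..} (\<lambda>t. G t \<epsilon>)" "((\<lambda>t. G t \<epsilon> / t) \<longlongrightarrow> 0) at_top"
    if "0 < \<epsilon>" for \<epsilon>
    using g that unfolding G_def extend_mistake_def flow_mistake_function_def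
    by (cases "\<epsilon> \<le> \<epsilon>\<^sub>0"; simp)+
  obtain \<delta> where \<delta>: "\<And>\<epsilon>. 0 < \<epsilon> \<Longrightarrow> 0 < \<delta> \<epsilon>"
    "\<And>\<epsilon> s x y. 0 < \<epsilon> \<Longrightarrow> \<bar>s\<bar> \<le> \<tau> \<Longrightarrow> dist x y < \<delta> \<epsilon> \<Longrightarrow> dist (\<Phi> s x) (\<Phi> s y) < \<epsilon>"
    using flow_modulus[OF comp flow] by blast
  define h where "h n \<epsilon> = nat \<lfloor>G (real n * \<tau>) (\<delta> \<epsilon>) / \<tau>\<rfloor>" for n \<epsilon>
  have h_lim: "(\<lambda>n. real (h n \<epsilon>) / real n) \<longlonglongrightarrow> 0" if "0 < \<epsilon>" for \<epsilon>
  proof (rule tendsto_sandwich[OF _ _ tendsto_const])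
    have "filterlim (\<lambda>n. real n * \<tau>) at_top sequentially"
      using \<tau> by (intro filterlim_at_top_mult_tendsto_pos[OF tendsto_const] filterlim_real_sequentially)
    from filterlim_compose[OF G(3)[OF \<delta>(1)[OF that]] this]
    show "(\<lambda>n. G (real n * \<tau>) (\<delta> \<epsilon>) / (real n * \<tau>)) \<longlonglongrightarrow> 0" .
    show "\<forall>\<^sub>F n in sequentially. real (h n \<epsilon>) / real n \<le> G (real n * \<tau>) (\<delta> \<epsilon>) / (real n * \<tau>)"
      using eventually_gt_at_top[of 0]
    proof eventually_elim
      case (elim n)
      have "0 \<le> G (real n * \<tau>) (\<delta> \<epsilon>) / \<tau>" using G(1)[OF \<delta>(1)[OF that], of "real n * \<tau>"] elim \<tau> by simp
      then have "real (h n \<epsilon>) \<le> G (real n * \<tau>) (\<delta> \<epsilon>) / \<tau>" unfolding h_def by simp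
      then show ?case using elim by (simp add: field_simps)
    qed
  qed auto
  have h_mono: "mono_on {1..} (\<lambda>n. h n \<epsilon>)" if "0 < \<epsilon>" for \<epsilon>
  proof (rule mono_onI)
    fix m n :: nat assume "m \<in> {1..}" "n \<in> {1..}" "m \<le> n"
    then have "G (real m * \<tau>) (\<delta> \<epsilon>) \<le> G (real n * \<tau>) (\<delta> \<epsilon>)"
      using \<tau> by (intro mono_onD[OF G(2)[OF \<delta>(1)[OF that]]]) auto
    then show "h m \<epsilon> \<le> h n \<epsilon>" unfolding h_def using \<tau> by (intro nat_mono floor_mono divide_right_mono) auto
  qed
  have "\<forall>\<epsilon>. \<exists>N. 0 < \<epsilon> \<longrightarrow> (\<forall>n\<ge>N. h n \<epsilon> < n)"
  proof (intro allI)
    fix \<epsilon> :: real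
    have "\<exists>N. \<forall>n\<ge>N. h n \<epsilon> < n" if "0 < \<epsilon>"
    proof -
      have "\<forall>\<^sub>F n in sequentially. real (h n \<epsilon>) / real n < 1"
        using h_lim[OF that] by (rule order_tendstoD) simp
      then have "\<forall>\<^sub>F n in sequentially. h n \<epsilon> < n"
        using eventually_gt_at_top[of 0] by eventually_elim (simp add: field_simps)
      then show ?thesis by (simp add: eventually_sequentially)
    qed
    then show "\<exists>N. 0 < \<epsilon> \<longrightarrow> (\<forall>n\<ge>N. h n \<epsilon> < n)" by blast
  qed
  then obtain L where L: "\<And>\<epsilon> n. 0 < \<epsilon> \<Longrightarrow> L \<epsilon> \<le> n \<Longrightarrow> h n \<epsilon> < n" by metis
  have ext: "extend_mistake 1 h n \<epsilon> = h n (min \<epsilon> 1)" for n \<epsilon>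
    by (simp add: extend_mistake_def min_def)
  show ?thesis
    unfolding almost_specification_def
  proof (rule exI[of _ 1], rule exI[of _ h], intro conjI allI impI)
    show "mistake_function 1 h"
      unfolding mistake_function_def using h_lim h_mono by auto
  next
    fix k :: nat and \<epsilon> :: "nat \<Rightarrow> real"
    assume k: "1 \<le> k" and \<epsilon>: "\<forall>i<k. 0 < \<epsilon> i"
    define d where "d e = \<delta> (min e 1)" for e
    have "\<forall>i<k. 0 < d (\<epsilon> i)" unfolding d_def using \<epsilon> \<delta>(1) by simp
    from glue[OF k this] obtain T :: "real \<Rightarrow> real" where
      T: "\<And>x t. \<forall>i<k. t i \<ge> T (d (\<epsilon> i)) \<Longrightarrow> \<exists>z. \<forall>j<k. \<Phi> (\<Sum>i<j. t i) z
            \<in> flow_mistake_ball \<Phi> G (t j) (x j) (d (\<epsilon> j))"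
      unfolding G_def by blast
    define N where "N e = max (L (min e 1)) (nat \<lceil>T (d e) / \<tau>\<rceil>)" for e
    show "\<exists>N :: real \<Rightarrow> nat.
              (\<forall>i<k. \<forall>n\<ge>N (\<epsilon> i). extend_mistake 1 h n (\<epsilon> i) < n) \<and>
              (\<forall>(x :: nat \<Rightarrow> 'a) (n :: nat \<Rightarrow> nat). (\<forall>i<k. n i \<ge> N (\<epsilon> i)) \<longrightarrow>
                 (\<exists>z. \<forall>j<k. (\<Phi> \<tau> ^^ (\<Sum>i<j. n i)) z
                        \<in> mistake_ball (\<Phi> \<tau>) (extend_mistake 1 h) (n j) (x j) (\<epsilon> j)))"
    proof (intro exI[of _ N] conjI allI impI)
      fix i n assume "i < k" "N (\<epsilon> i) \<le> n"
      then show "extend_mistake 1 h n (\<epsilon> i) < n"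
        unfolding ext N_def using L[of "min (\<epsilon> i) 1" n] \<epsilon> by simp
    next
      fix x :: "nat \<Rightarrow> 'a" and n :: "nat \<Rightarrow> nat"
      assume n: "\<forall>i<k. N (\<epsilon> i) \<le> n i"
      have "T (d (\<epsilon> i)) \<le> real (n i) * \<tau>" if "i < k" for i
      proof -
        have "nat \<lceil>T (d (\<epsilon> i)) / \<tau>\<rceil> \<le> n i" using n that unfolding N_def by auto
        then have "T (d (\<epsilon> i)) / \<tau> \<le> real (n i)" by linarith
        then show ?thesis using \<tau> by (simp add: field_simps)
      qed
      then obtain z where z: "\<And>j. j < k \<Longrightarrow> \<Phi> (\<Sum>i<j. real (n i) * \<tau>) z
            \<in> flow_mistake_ball \<Phi> G (real (n j) * \<tau>) (x j) (d (\<epsilon> j))"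
        using T[of "\<lambda>i. real (n i) * \<tau>" x] by blast
      show "\<exists>z. \<forall>j<k. (\<Phi> \<tau> ^^ (\<Sum>i<j. n i)) z
                        \<in> mistake_ball (\<Phi> \<tau>) (extend_mistake 1 h) (n j) (x j) (\<epsilon> j)"
      proof (intro exI[of _ z] allI impI)
        fix j assume j: "j < k"
        have pos: "0 < min (\<epsilon> j) 1" using \<epsilon> j by simp
        show "(\<Phi> \<tau> ^^ (\<Sum>i<j. n i)) z \<in> mistake_ball (\<Phi> \<tau>) (extend_mistake 1 h) (n j) (x j) (\<epsilon> j)"
          unfolding flow_funpow[OF flow]
        proof (rule mistake_ball_of_flow_mistake_ball[OF comp flow \<tau>])
          show "dist (\<Phi> s u) (\<Phi> s v) < \<epsilon> j" if "\<bar>s\<bar> \<le> \<tau>" "dist u v < d (\<epsilon> j)" for s u v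
            using \<delta>(2)[OF pos that(1) that(2)[unfolded d_def]] by simp
          show "\<Phi> (real (\<Sum>i<j. n i) * \<tau>) z \<in> flow_mistake_ball \<Phi> G (real (n j) * \<tau>) (x j) (d (\<epsilon> j))"
            using z[OF j] by (simp add: sum_distrib_right)
          show "G (real (n j) * \<tau>) (d (\<epsilon> j)) / \<tau> < real (extend_mistake 1 h (n j) (\<epsilon> j)) + 1"
            unfolding ext h_def d_def by linarith
        qed
      qed
    qed
  qed
qed

section \<open>From the time map to the flow\<close>

text \<open>The upper envelope \<open>G s = sup\<^sub>n a n * min 1 (s / (n \<tau>))\<close>: every member is nondecreasing, reaches
  \<open>a n\<close> at \<open>s = n \<tau>\<close>, and has slope at most \<open>a n / (n \<tau>)\<close>. These slopes are bounded, which makes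
  the supremum Lipschitz. They tend to 0, which makes it sublinear: the members of large index
  lie below a line of small slope and the finitely many others are bounded.\<close>

lemma sublinear_majorant:
  fixes a :: "nat \<Rightarrow> real"
  assumes \<tau>: "0 < \<tau>" and pos: "\<And>n. 0 < a n" and lim: "(\<lambda>n. a n / real n) \<longlonglongrightarrow> 0"
  obtains G :: "real \<Rightarrow> real" where "\<And>s. 0 < s \<Longrightarrow> 0 < G s" "continuous_on {0<..} G" "mono_on {0<..} G"
    "((\<lambda>s. G s / s) \<longlongrightarrow> 0) at_top" "\<And>n s. 1 \<le> n \<Longrightarrow> real n * \<tau> \<le> s \<Longrightarrow> a n \<le> G s"
proof -
  define b where "b n = a n / (real n * \<tau>)" for n
  define F where "F s n = a n * min 1 (s / (real n * \<tau>))" for s n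
  define G where "G s = (SUP n\<in>{1..}. F s n)" for s
  have b_lim: "b \<longlonglongrightarrow> 0"
    using tendsto_mult_right[OF lim, of "1 / \<tau>"] by (simp add: b_def[abs_def])
  then have "Bseq b" by (intro convergent_imp_Bseq convergentI)
  then obtain C where "0 < C" and C_norm: "\<forall>n. norm (b n) \<le> C" by (rule BseqE)
  have C: "b n \<le> C" "0 \<le> C" for n
    using C_norm[rule_format, of n] \<open>0 < C\<close> by auto
  have F_le_a: "F s n \<le> a n" for s n
    unfolding F_def using pos[of n] by (intro mult_left_le) auto
  have F_le_b: "F s n \<le> b n * s" for s n
  proof -
    have "a n * min 1 (s / (real n * \<tau>)) \<le> a n * (s / (real n * \<tau>))"
      using pos[of n] by (intro mult_left_mono) auto
    then show ?thesis by (simp add: F_def b_def)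
  qed
  have bdd: "bdd_above (F s ` {1..})" if "0 < s" for s
  proof (rule bdd_aboveI2)
    show "F s n \<le> C * s" for n
      using order_trans[OF F_le_b mult_right_mono[OF C(1) less_imp_le[OF that]]] .
  qed
  have F_le_G: "F s n \<le> G s" if "0 < s" "1 \<le> n" for s n
    unfolding G_def using that by (intro cSUP_upper bdd) auto
  have G_le: "G s \<le> c" if "\<And>n. 1 \<le> n \<Longrightarrow> F s n \<le> c" for s c
    unfolding G_def using that by (intro cSUP_least) auto
  have G_pos: "0 < G s" if "0 < s" for s
  proof -
    have "0 < F s 1" unfolding F_def using pos that \<tau> by simp
    also have "\<dots> \<le> G s" using that by (intro F_le_G) auto
    finally show ?thesis .
  qed
  have G_mono: "G s \<le> G s'" if "0 < s" "s \<le> s'" for s s'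
  proof (rule G_le)
    fix n :: nat assume n: "1 \<le> n"
    have "F s n \<le> F s' n" unfolding F_def using that n \<tau> pos[of n]
      by (intro mult_left_mono min.mono divide_right_mono) auto
    also have "\<dots> \<le> G s'" using that n by (intro F_le_G) auto
    finally show "F s n \<le> G s'" .
  qed
  have G_growth: "G s' \<le> G s + C * (s' - s)" if "0 < s" "s \<le> s'" for s s'
  proof (rule G_le)
    fix n :: nat assume n: "1 \<le> n"
    have min_growth: "min 1 (s' / (real n * \<tau>)) \<le> min 1 (s / (real n * \<tau>)) + (s' - s) / (real n * \<tau>)"
    proof -
      have "0 \<le> (s' - s) / (real n * \<tau>)" using that \<tau> by simp
      moreover have "s' / (real n * \<tau>) = s / (real n * \<tau>) + (s' - s) / (real n * \<tau>)" by (simp add: diff_divide_distrib)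
      ultimately show ?thesis by linarith
    qed
    have "F s' n \<le> F s n + b n * (s' - s)"
      using mult_left_mono[OF min_growth less_imp_le[OF pos[of n]]]
      by (simp add: F_def b_def distrib_left)
    also have "\<dots> \<le> G s + C * (s' - s)"
      using that n C by (intro add_mono F_le_G mult_right_mono) auto
    finally show "F s' n \<le> G s + C * (s' - s)" .
  qed
  have "C-lipschitz_on {0<..} G"
  proof (rule lipschitz_on_leI)
    fix s s' :: real assume "s \<in> {0<..}" "s' \<in> {0<..}" "s \<le> s'"
    then show "dist (G s) (G s') \<le> C * dist s s'"
      using G_growth[of s s'] G_mono[of s s'] by (simp add: dist_real_def)
  qed (rule C(2))
  then have cont: "continuous_on {0<..} G" by (rule lipschitz_on_continuous_on)
  have G_lim: "((\<lambda>s. G s / s) \<longlongrightarrow> 0) at_top"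
  proof (rule tendstoI)
    fix e :: real assume e: "0 < e"
    obtain N where N: "\<And>n. n \<ge> N \<Longrightarrow> b n < e / 2"
      using order_tendstoD(2)[OF b_lim, of "e / 2"] e by (auto simp: eventually_sequentially)
    have "\<forall>\<^sub>F s in at_top. (\<Sum>n<N. a n) / (e / 2) \<le> s" by (rule eventually_ge_at_top)
    then show "\<forall>\<^sub>F s in at_top. dist (G s / s) 0 < e"
      using eventually_gt_at_top[of 0]
    proof eventually_elim
      case (elim s)
      have "G s \<le> e / 2 * s"
      proof (rule G_le)
        fix n :: nat assume "1 \<le> n"
        show "F s n \<le> e / 2 * s"
        proof (cases "n < N")
          case True
          then have "a n \<le> (\<Sum>n<N. a n)" using pos by (intro member_le_sum) (auto intro: less_imp_le)
          then show ?thesis using elim e F_le_a[of s n] by (simp add: field_simps)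
        next
          case False
          then have "b n * s \<le> e / 2 * s" using N[of n] elim by (intro mult_right_mono) auto
          then show ?thesis by (rule order_trans[OF F_le_b])
        qed
      qed
      moreover have "e / 2 * s < e * s" using e elim by simp
      ultimately have "G s / s < e" using elim by (simp add: field_simps)
      then show ?case using G_pos[of s] elim by simp
    qed
  qed
  have G_ge: "a n \<le> G s" if "1 \<le> n" "real n * \<tau> \<le> s" for n s
  proof -
    have "0 < real n * \<tau>" using that \<tau> by simp
    then have "F s n = a n" "0 < s" unfolding F_def using that by (auto simp: min_def field_simps)
    then show ?thesis using F_le_G that by metis
  qed
  have "mono_on {0<..} G" using G_mono by (auto simp: mono_on_def)
  from that[OF G_pos cont this G_lim G_ge] show ?thesis .
qed

text \<open>The iterates of the map are only compared from time \<open>c\<close> on, the first grid time of the segment.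
  Every bad time lies in \<open>[0, c]\<close> or in the block of a bad iterate. The good times are taken with
  the non-strict bound \<open>\<epsilon>'\<close>, so that they form a closed, hence measurable, set and
  the supremum over them stays strictly below \<open>\<epsilon>\<close>.\<close>

lemma flow_mistake_ball_of_mistake_ball:
  fixes \<Phi> :: "real \<Rightarrow> 'a::metric_space \<Rightarrow> 'a"
  assumes flow: "continuous_flow \<Phi>" and \<tau>: "0 < \<tau>" and \<epsilon>': "\<epsilon>' < \<epsilon>"
    and modulus: "\<And>s x y. \<bar>s\<bar> \<le> \<tau> \<Longrightarrow> dist x y < \<delta> \<Longrightarrow> dist (\<Phi> s x) (\<Phi> s y) < \<epsilon>'"
    and c: "0 \<le> c" "c \<le> \<tau>" and cover: "T \<le> c + real n * \<tau>"
    and y: "\<Phi> c y \<in> mistake_ball (\<Phi> \<tau>) g n (\<Phi> c x) \<delta>"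
    and G: "\<tau> * (1 + real (g n \<delta>)) \<le> G T \<epsilon>"
  shows "y \<in> flow_mistake_ball \<Phi> G T x \<epsilon>"
proof -
  obtain L where L: "L \<subseteq> {0..<n}" "n - g n \<delta> \<le> card L"
    and close: "\<And>j. j \<in> L \<Longrightarrow> dist ((\<Phi> \<tau> ^^ j) (\<Phi> c x)) ((\<Phi> \<tau> ^^ j) (\<Phi> c y)) < \<delta>"
    using y unfolding mistake_ball_def by blast
  define B where "B = {0..<n} - L"
  have finB: "finite B" by (simp add: B_def)
  have cardB: "card B \<le> g n \<delta>"
    using L card_Diff_subset[OF finite_subset[OF L(1)] L(1)] by (simp add: B_def)
  define I where "I j = {c + real j * \<tau>..c + real j * \<tau> + \<tau>}" for j :: nat
  define \<Lambda> where "\<Lambda> = {u\<in>{0..T}. dist (\<Phi> u x) (\<Phi> u y) \<le> \<epsilon>'}"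
  have "\<Lambda> = {0..T} \<inter> {u. dist (\<Phi> u x) (\<Phi> u y) \<le> \<epsilon>'}" by (auto simp: \<Lambda>_def)
  then have "closed \<Lambda>"
    by (simp add: closed_Int closed_Collect_le continuous_on_dist continuous_on_flow_time[OF flow])
  then have sets: "\<Lambda> \<in> sets lebesgue" by (simp add: borel_closed)
  have cover_bad: "{0..T} - \<Lambda> \<subseteq> {0..c} \<union> (\<Union>j\<in>B. I j)"
  proof
    fix u assume u: "u \<in> {0..T} - \<Lambda>"
    show "u \<in> {0..c} \<union> (\<Union>j\<in>B. I j)"
    proof (cases "u < c")
      case False
      \<comment> \<open>The ceiling, rather than the floor, keeps the last moment of the last block in range.\<close>
      define j where "j = nat (\<lceil>(u - c) / \<tau>\<rceil> - 1)"
      show ?thesis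
      proof (cases "u = c")
        case False
        with \<open>\<not> u < c\<close> have "0 < (u - c) / \<tau>" using \<tau> by simp
        then have j: "real j < (u - c) / \<tau>" "(u - c) / \<tau> \<le> real j + 1"
          unfolding j_def by linarith+
        then have uj: "c + real j * \<tau> \<le> u" "u \<le> c + real j * \<tau> + \<tau>"
          using \<tau> by (simp_all add: field_simps)
        have "(u - c) / \<tau> \<le> real n" using u cover \<tau> by (simp add: field_simps)
        then have "j < n" using j(1) by linarith
        moreover have "j \<notin> L"
        proof
          assume "j \<in> L"
          have "\<bar>u - (c + real j * \<tau>)\<bar> \<le> \<tau>" using uj by simp
          from modulus[OF this close[OF \<open>j \<in> L\<close>]] have "dist (\<Phi> u x) (\<Phi> u y) < \<epsilon>'"
            by (simp add: flow_add[OF flow] flow_funpow[OF flow])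
          then show False using u by (auto simp: \<Lambda>_def)
        qed
        ultimately show ?thesis using uj by (auto simp: B_def I_def)
      qed (use c in auto)
    qed (use u in simp)
  qed
  have "measure lebesgue ({0..T} - \<Lambda>) \<le> measure lebesgue ({0..c} \<union> (\<Union>j\<in>B. I j))"
    using sets by (intro measure_mono_fmeasurable[OF cover_bad] fmeasurable.Un fmeasurable.finite_UN finB sets.Diff) (auto simp: I_def)
  also have "\<dots> \<le> measure lebesgue {0..c} + measure lebesgue (\<Union>j\<in>B. I j)"
    by (rule measure_Un_le) (auto simp: I_def finB intro!: sets.finite_UN)
  also have "measure lebesgue (\<Union>j\<in>B. I j) \<le> (\<Sum>j\<in>B. measure lebesgue (I j))"
    by (rule measure_UNION_le[OF finB]) (auto simp: I_def)
  also have "\<dots> = real (card B) * \<tau>" using \<tau> by (simp add: I_def)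
  also have "measure lebesgue {0..c} + real (card B) * \<tau> \<le> \<tau> + real (g n \<delta>) * \<tau>"
    using c cardB \<tau> by (intro add_mono mult_right_mono) auto
  also have "\<dots> \<le> G T \<epsilon>" using G by (simp add: algebra_simps)
  finally have "measure lebesgue ({0..T} - \<Lambda>) \<le> G T \<epsilon>" by simp
  moreover have "(SUP t\<in>\<Lambda>. dist (\<Phi> t x) (\<Phi> t y)) < \<epsilon>" if "\<Lambda> \<noteq> {}"
  proof -
    have "(SUP t\<in>\<Lambda>. dist (\<Phi> t x) (\<Phi> t y)) \<le> \<epsilon>'" using that by (intro cSUP_least) (auto simp: \<Lambda>_def)
    then show ?thesis using \<epsilon>' by simp
  qed
  moreover have "\<Lambda> \<subseteq> {0..T}" by (auto simp: \<Lambda>_def)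
  ultimately show ?thesis unfolding flow_mistake_ball_def using sets by blast
qed

text \<open>Since \<open>n\<^sub>j < t\<^sub>j / \<tau> + 1\<close>, the number \<open>n\<^sub>j\<close> of iterates is at most \<open>q + 1\<close> with \<open>q = \<lfloor>t\<^sub>j / \<tau>\<rfloor>\<close>, so the
  bad times of a segment have measure at most \<open>a q = \<tau> (1 + G (q + 1))\<close>, where \<open>G\<close> is the extended
  mistake function of the map. A majorant of the sequence \<open>a\<close> is the mistake function of the flow.\<close>

lemma flow_almost_specification_of_map:
  fixes \<Phi> :: "real \<Rightarrow> 'a::metric_space \<Rightarrow> 'a"
  assumes comp: "compact (UNIV :: 'a set)" and flow: "continuous_flow \<Phi>" and \<tau>: "0 < \<tau>"
    and almost_spec: "almost_specification (\<Phi> \<tau>)"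
  shows "flow_almost_specification \<Phi>"
proof -
  obtain \<epsilon>\<^sub>0 g where g: "mistake_function \<epsilon>\<^sub>0 g"
    and glue: "\<And>(k :: nat) (\<epsilon> :: nat \<Rightarrow> real). k \<ge> 1 \<Longrightarrow> \<forall>i<k. 0 < \<epsilon> i \<Longrightarrow>
       \<exists>N :: real \<Rightarrow> nat. (\<forall>i<k. \<forall>n\<ge>N (\<epsilon> i). extend_mistake \<epsilon>\<^sub>0 g n (\<epsilon> i) < n) \<and>
         (\<forall>x n. (\<forall>i<k. n i \<ge> N (\<epsilon> i)) \<longrightarrow>
           (\<exists>z. \<forall>j<k. (\<Phi> \<tau> ^^ (\<Sum>i<j. n i)) z
                  \<in> mistake_ball (\<Phi> \<tau>) (extend_mistake \<epsilon>\<^sub>0 g) (n j) (x j) (\<epsilon> j)))"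
    using almost_spec unfolding almost_specification_def
    by (elim exE conjE) (rule that, assumption, drule spec, drule (1) mp, drule spec, drule (1) mp, assumption)
  define G where "G = extend_mistake \<epsilon>\<^sub>0 g"
  have G: "mono_on {1..} (\<lambda>n. G n \<epsilon>)" "(\<lambda>n. real (G n \<epsilon>) / real n) \<longlonglongrightarrow> 0"
    if "0 < \<epsilon>" for \<epsilon>
    using g that unfolding G_def extend_mistake_def mistake_function_def
    by (cases "\<epsilon> \<le> \<epsilon>\<^sub>0"; simp)+
  obtain \<delta> where \<delta>: "\<And>\<epsilon>. 0 < \<epsilon> \<Longrightarrow> 0 < \<delta> \<epsilon>"
    "\<And>\<epsilon> s x y. 0 < \<epsilon> \<Longrightarrow> \<bar>s\<bar> \<le> \<tau> \<Longrightarrow> dist x y < \<delta> \<epsilon> \<Longrightarrow> dist (\<Phi> s x) (\<Phi> s y) < \<epsilon>"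
    using flow_modulus[OF comp flow] by blast
  define d where "d e = \<delta> (min e 1 / 2)" for e
  have d: "0 < d e" if "0 < e" for e unfolding d_def using \<delta>(1)[of "min e 1 / 2"] that by simp
  define a where "a e n = \<tau> * (1 + real (G (n + 1) (d e)))" for e n
  define majorant where "majorant e H \<longleftrightarrow> (\<forall>s>0. 0 < H s) \<and> continuous_on {0<..} H \<and> mono_on {0<..} H \<and>
    ((\<lambda>s. H s / s) \<longlongrightarrow> 0) at_top \<and> (\<forall>n\<ge>1. \<forall>s. real n * \<tau> \<le> s \<longrightarrow> a e n \<le> H s)"
    for e and H :: "real \<Rightarrow> real"
  have "\<exists>H. majorant e H" if "0 < e" for e
  proof -
    have a_pos: "0 < a e n" for n unfolding a_def using \<tau> by (simp add: add_pos_nonneg)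
    have a_lim: "(\<lambda>n. a e n / real n) \<longlonglongrightarrow> 0"
    proof -
      have "(\<lambda>n. real (G (n + 1) (d e)) / real (n + 1)) \<longlonglongrightarrow> 0"
        using LIMSEQ_ignore_initial_segment[OF G(2)[OF d[OF that]], of 1] .
      moreover have "(\<lambda>n. real (n + 1) / real n) \<longlonglongrightarrow> 1"
        using LIMSEQ_Suc_n_over_n by (simp add: add.commute)
      ultimately have "(\<lambda>n. \<tau> * (1 / real n + real (G (n + 1) (d e)) / real (n + 1) * (real (n + 1) / real n))) \<longlonglongrightarrow> \<tau> * (0 + 0 * 1)"
        by (intro tendsto_intros lim_1_over_n)
      moreover have "\<tau> * (1 / real n + real (G (n + 1) (d e)) / real (n + 1) * (real (n + 1) / real n)) = a e n / real n" for n
      proof -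
        have cancel: "p / q * (q / r) = p / r" if "q \<noteq> 0" for p q r :: real using that by simp
        show ?thesis unfolding a_def by (subst cancel) (simp_all add: add_divide_distrib distrib_left)
      qed
      ultimately show ?thesis by simp
    qed
    show ?thesis
    proof (rule sublinear_majorant[OF \<tau> a_pos a_lim])
      fix H :: "real \<Rightarrow> real"
      assume "\<And>s. 0 < s \<Longrightarrow> 0 < H s" "continuous_on {0<..} H" "mono_on {0<..} H"
        "((\<lambda>s. H s / s) \<longlongrightarrow> 0) at_top" "\<And>n s. 1 \<le> n \<Longrightarrow> real n * \<tau> \<le> s \<Longrightarrow> a e n \<le> H s"
      then show ?thesis unfolding majorant_def by (intro exI[of _ H]) simp
    qed
  qed
  then have "\<forall>e. \<exists>H. 0 < e \<longrightarrow> majorant e H" by blast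
  from choice[OF this] obtain H where "\<forall>e. 0 < e \<longrightarrow> majorant e (H e)" by blast
  then have H: "0 < s \<Longrightarrow> 0 < H e s" "continuous_on {0<..} (H e)" "mono_on {0<..} (H e)"
    "((\<lambda>s. H e s / s) \<longlongrightarrow> 0) at_top" "1 \<le> n \<Longrightarrow> real n * \<tau> \<le> s \<Longrightarrow> a e n \<le> H e s"
    if "0 < e" for e s n
    using that unfolding majorant_def by blast+
  define h where "h s e = H e s" for s e
  have ext: "extend_mistake 1 h s e = H (min e 1) s" for s e
    by (simp add: extend_mistake_def min_def h_def)
  show ?thesis
    unfolding flow_almost_specification_def
  proof (rule exI[of _ 1], rule exI[of _ h], intro conjI allI impI)
    show "flow_mistake_function 1 h"
      unfolding flow_mistake_function_def h_def using H by auto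
  next
    fix k :: nat and \<epsilon> :: "nat \<Rightarrow> real"
    assume k: "1 \<le> k" and \<epsilon>: "\<forall>i<k. 0 < \<epsilon> i"
    have "\<forall>i<k. 0 < d (\<epsilon> i)" using \<epsilon> d by simp
    from glue[OF k this] obtain N :: "real \<Rightarrow> nat" where
      N: "\<And>x n. \<forall>i<k. n i \<ge> N (d (\<epsilon> i)) \<Longrightarrow> \<exists>z. \<forall>j<k. (\<Phi> \<tau> ^^ (\<Sum>i<j. n i)) z
            \<in> mistake_ball (\<Phi> \<tau>) G (n j) (x j) (d (\<epsilon> j))"
      unfolding G_def by blast
    \<comment> \<open>Rounding costs a segment less than one iterate, so at least \<open>N (d e)\<close> iterates remain; the second
      unit makes this count positive, which the monotonicity of \<open>G\<close> on positive lengths needs.\<close>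
    define T where "T e = (real (N (d e)) + 2) * \<tau>" for e
    show "\<exists>T :: real \<Rightarrow> real. (\<forall>i<k. 0 < T (\<epsilon> i)) \<and>
              (\<forall>(x :: nat \<Rightarrow> 'a) (t :: nat \<Rightarrow> real). (\<forall>i<k. t i \<ge> T (\<epsilon> i)) \<longrightarrow>
                 (\<exists>z. \<forall>j<k. \<Phi> (\<Sum>i<j. t i) z
                        \<in> flow_mistake_ball \<Phi> (extend_mistake 1 h) (t j) (x j) (\<epsilon> j)))"
    proof (intro exI[of _ T] conjI allI impI)
      show "0 < T (\<epsilon> i)" for i unfolding T_def using \<tau> by (simp add: add_nonneg_pos)
    next
      fix x :: "nat \<Rightarrow> 'a" and t :: "nat \<Rightarrow> real"
      assume t: "\<forall>i<k. T (\<epsilon> i) \<le> t i"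
      define S where "S j = (\<Sum>i<j. t i)" for j
      define m where "m j = nat \<lceil>S j / \<tau>\<rceil>" for j
      define n where "n j = m (Suc j) - m j" for j
      \<comment> \<open>The waiting time from the start of the flow segment to the next grid time.\<close>
      define c where "c j = real (m j) * \<tau> - S j" for j
      have t_ge: "real (N (d (\<epsilon> i))) + 2 \<le> t i / \<tau>" if "i < k" for i
        using t that \<tau> unfolding T_def by (auto simp: field_simps)
      have t_pos: "0 < t i" if "i < k" for i
      proof -
        have "0 < t i / \<tau>" using t_ge[OF that] by linarith
        then show ?thesis using \<tau> by (simp add: zero_less_divide_iff)
      qed
      have S_nonneg: "0 \<le> S j" if "j \<le> k" for j
        unfolding S_def using t_pos that by (intro sum_nonneg) (auto intro: less_imp_le)
      have m: "S j / \<tau> \<le> real (m j)" "real (m j) < S j / \<tau> + 1" if "j \<le> k" for j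
      proof -
        have "0 \<le> S j / \<tau>" using S_nonneg[OF that] \<tau> by simp
        then show "S j / \<tau> \<le> real (m j)" "real (m j) < S j / \<tau> + 1" unfolding m_def by linarith+
      qed
      have S_Suc: "S (Suc j) / \<tau> = S j / \<tau> + t j / \<tau>" for j
        by (simp add: S_def add_divide_distrib)
      have m_Suc: "real (n j) = real (m (Suc j)) - real (m j)" if "j < k" for j
      proof -
        have "real (m j) \<le> real (m (Suc j))"
          using m[of j] m[of "Suc j"] S_Suc[of j] t_ge[OF that] that by simp
        then show ?thesis unfolding n_def by simp
      qed
      have n_ge: "N (d (\<epsilon> j)) \<le> n j" and n_le: "real (n j) < t j / \<tau> + 1" if "j < k" for j
      proof -
        have "real (N (d (\<epsilon> j))) \<le> real (n j)"
          using m[of j] m[of "Suc j"] S_Suc[of j] t_ge[OF that] m_Suc[OF that] that by simp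
        then show "N (d (\<epsilon> j)) \<le> n j" by simp
        show "real (n j) < t j / \<tau> + 1"
          using m[of j] m[of "Suc j"] S_Suc[of j] m_Suc[OF that] that by simp
      qed
      have m_sum: "(\<Sum>i<j. n i) = m j" if "j \<le> k" for j
      proof -
        have "real (\<Sum>i<j. n i) = (\<Sum>i<j. real (m (Suc i)) - real (m i))"
          using m_Suc that by simp
        also have "\<dots> = real (m j) - real (m 0)" by (rule sum_lessThan_telescope)
        also have "\<dots> = real (m j)" by (simp add: m_def S_def)
        finally show ?thesis by (simp only: of_nat_eq_iff)
      qed
      have "\<forall>i<k. N (d (\<epsilon> i)) \<le> n i" using n_ge by blast
      from N[OF this, of "\<lambda>j. \<Phi> (c j) (x j)"] obtain z where
        z: "\<And>j. j < k \<Longrightarrow> (\<Phi> \<tau> ^^ (\<Sum>i<j. n i)) z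
            \<in> mistake_ball (\<Phi> \<tau>) G (n j) (\<Phi> (c j) (x j)) (d (\<epsilon> j))" by blast
      show "\<exists>z. \<forall>j<k. \<Phi> (\<Sum>i<j. t i) z
                        \<in> flow_mistake_ball \<Phi> (extend_mistake 1 h) (t j) (x j) (\<epsilon> j)"
      proof (intro exI[of _ z] allI impI)
        fix j assume j: "j < k"
        have pos: "0 < min (\<epsilon> j) 1" using \<epsilon> j by simp
        show "\<Phi> (\<Sum>i<j. t i) z \<in> flow_mistake_ball \<Phi> (extend_mistake 1 h) (t j) (x j) (\<epsilon> j)"
        proof (rule flow_mistake_ball_of_mistake_ball[OF flow \<tau>])
          show "min (\<epsilon> j) 1 / 2 < \<epsilon> j" using pos by linarith
          show "dist (\<Phi> s u) (\<Phi> s v) < min (\<epsilon> j) 1 / 2" if "\<bar>s\<bar> \<le> \<tau>" "dist u v < d (\<epsilon> j)" for s u v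
            using \<delta>(2)[of "min (\<epsilon> j) 1 / 2", OF _ that(1) that(2)[unfolded d_def]] pos by simp
          show "0 \<le> c j" "c j \<le> \<tau>"
            using m[of j] j \<tau> by (simp_all add: c_def field_simps)
          show "t j \<le> c j + real (n j) * \<tau>"
            using m(1)[of "Suc j"] j \<tau> unfolding c_def m_Suc[OF j] by (simp add: S_def field_simps)
          show "\<Phi> (c j) (\<Phi> (\<Sum>i<j. t i) z) \<in> mistake_ball (\<Phi> \<tau>) G (n j) (\<Phi> (c j) (x j)) (d (\<epsilon> j))"
            using z[OF j] m_sum[of j] j by (simp add: flow_add[OF flow] flow_funpow[OF flow] c_def S_def)
          show "\<tau> * (1 + real (G (n j) (d (\<epsilon> j)))) \<le> extend_mistake 1 h (t j) (\<epsilon> j)"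
          proof -
            define q where "q = nat \<lfloor>t j / \<tau>\<rfloor>"
            have q: "1 \<le> q" "real q \<le> t j / \<tau>" "n j \<le> q + 1"
              unfolding q_def using t_ge[OF j] n_le[OF j] by linarith+
            have "1 \<le> n j"
              using m[of j] m[of "Suc j"] S_Suc[of j] t_ge[OF j] m_Suc[OF j] j by simp
            then have "G (n j) (d (\<epsilon> j)) \<le> G (q + 1) (d (\<epsilon> j))"
              using q(3) d \<epsilon> j by (intro mono_onD[OF G(1)]) auto
            then have "\<tau> * (1 + real (G (n j) (d (\<epsilon> j)))) \<le> a (min (\<epsilon> j) 1) q"
              unfolding a_def d_def using \<tau> by simp
            also have "\<dots> \<le> H (min (\<epsilon> j) 1) (t j)"
              using q \<tau> by (intro H(5) pos) (auto simp: field_simps)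
            finally show ?thesis unfolding ext .
          qed
        qed
      qed
    qed
  qed
qed

theorem theorem4:
  fixes \<Phi> :: "real \<Rightarrow> 'a::metric_space \<Rightarrow> 'a" and t :: real
  assumes "compact (UNIV :: 'a set)"
    and "continuous_flow \<Phi>"
    and "t \<noteq> 0"
  shows "flow_almost_specification \<Phi> \<longleftrightarrow> almost_specification (\<Phi> t)"
proof (cases "0 < t")
  case True
  then show ?thesis
    using almost_specification_of_flow[OF assms(1,2) True]
      flow_almost_specification_of_map[OF assms(1,2) True] by blast
next
  case False
  then have pos: "0 < - t" using assms(3) by simp
  define \<Psi> where "\<Psi> = (\<lambda>s. \<Phi> (- s))"
  have \<Psi>: "continuous_flow \<Psi>" unfolding \<Psi>_def by (rule continuous_flow_reverse[OF assms(2)])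
  have "flow_almost_specification \<Phi> \<longleftrightarrow> flow_almost_specification \<Psi>"
    using flow_almost_specification_reverse[OF assms(2)] flow_almost_specification_reverse[OF \<Psi>]
    by (auto simp: \<Psi>_def)
  also have "\<dots> \<longleftrightarrow> almost_specification (\<Psi> (- t))"
    using almost_specification_of_flow[OF assms(1) \<Psi> pos]
      flow_almost_specification_of_map[OF assms(1) \<Psi> pos] by blast
  finally show ?thesis by (simp add: \<Psi>_def)
qed

end
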